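(* Let $c<0$ and $\kappa>0$. If $$2u_p''(1)+(6-\cos\alpha-\beta)\,u_p'(1)+(2-\cos\alpha-\beta)\,(u_p(1)-1)\le \cos\alpha-\beta,$$ then the function $z\mapsto z\,u_p(z)$ belongs to the class $\mathcal{UCSP}(\alpha,\beta)$.
   Context: Throughout, $\alpha,\beta$ are real with $|\alpha|<\pi/2$ and $0\le\beta<1$. Let $\mathbb{U}=\{z\in\mathbb{C}:|z|<1\}$ and let $\mathcal{A}$ be the class of functions analytic in $\mathbb{U}$ of the form $f(z)=z+\sum_{n=2}^{\infty}a_nz^n$. A function $f\in\mathcal{A}$ belongs to $\mathcal{SP}_p(\alpha,\beta)$ if $\operatorname{Re}\left\{e^{-i\alpha}\frac{zf'(z)}{f(z)}\right\}>\left|\frac{zf'(z)}{f(z)}-1\right|+\beta$ for all $z\in\mathbb{U}$ (the quotient being read as its limit $1$ at $z=0$); the subscript $p$ in the name $\mathcal{SP}_p$ is only part of the notation. A function $f\in\mathcal{A}$ belongs to $\mathcal{UCSP}(\alpha,\beta)$ if and only if $zf'(z)\in\mathcal{SP}_p(\alpha,\beta)$. The generalized normalized Bessel function with parameters $p,b,c$ is the entire function $u_p(z)=\sum_{n=0}^{\infty}\frac{(-c/4)^n}{(\kappa)_n\,n!}z^n$, where $\kappa=p+(b+1)/2\ne 0,-1,-2,\ldots$ and $(a)_0=1$, $(a)_n=a(a+1)\cdots(a+n-1)$ for $n\ge1$. *)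

theory Defs
  imports "HOL-Complex_Analysis.Complex_Analysis"
begin

definition unit_disc :: "complex set" where
  "unit_disc = ball 0 1"

definition class_A :: "(complex \<Rightarrow> complex) set" where
  "class_A = {f. f holomorphic_on unit_disc \<and>
     (\<exists>a :: nat \<Rightarrow> complex. \<forall>z\<in>unit_disc. (\<lambda>n. a (n + 2) * z ^ (n + 2)) sums (f z - z))}"

text \<open>The quotient z f'(z) / f(z), with its limit 1 at the origin.\<close>
definition log_deriv_quot :: "(complex \<Rightarrow> complex) \<Rightarrow> complex \<Rightarrow> complex" where
  "log_deriv_quot f z = (if z = 0 then 1 else z * deriv f z / f z)"

text \<open>
  At a zero of f other than the origin the quotient is undefined; here it is 0 there, and since
  Re 0 > 1 + beta fails for every beta \<ge> 0, such an f is not in the class.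
\<close>
definition class_SP :: "real \<Rightarrow> real \<Rightarrow> (complex \<Rightarrow> complex) set" where
  "class_SP \<alpha> \<beta> = {f \<in> class_A. \<forall>z\<in>unit_disc.
     Re (exp (- \<i> * of_real \<alpha>) * log_deriv_quot f z) > cmod (log_deriv_quot f z - 1) + \<beta>}"

definition class_UCSP :: "real \<Rightarrow> real \<Rightarrow> (complex \<Rightarrow> complex) set" where
  "class_UCSP \<alpha> \<beta> = {f \<in> class_A. (\<lambda>z. z * deriv f z) \<in> class_SP \<alpha> \<beta>}"

definition bessel_kappa :: "complex \<Rightarrow> complex \<Rightarrow> complex" where
  "bessel_kappa p b = p + (b + 1) / 2"

text \<open>Meaningful when kappa is not 0, -1, -2, ...; otherwise some denominators vanish.\<close>
definition gen_bessel :: "complex \<Rightarrow> complex \<Rightarrow> complex \<Rightarrow> complex \<Rightarrow> complex" where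
  "gen_bessel p b c z =
     (\<Sum>n. (- c / 4) ^ n / (pochhammer (bessel_kappa p b) n * fact n) * z ^ n)"

end

theory Submission
  imports Defs
begin

text \<open>
  The function \<open>f z = z * u z\<close> has Taylor coefficients \<open>w (n - 1)\<close>, where
  \<open>w n = (-c/4)^n / (pochhammer \<kappa> n * fact n)\<close> is positive because \<open>c < 0 < \<kappa>\<close>. Belonging to
  \<open>class_UCSP\<close> means that \<open>g z = z * f' z\<close>, with coefficients \<open>n * w (n - 1)\<close>, is in \<open>class_SP\<close>.

  For membership in \<open>class_SP\<close> a coefficient estimate suffices. With \<open>q = z g' / g\<close> one has
  \<open>Re (e^{-i\<alpha>} q) \<ge> cos \<alpha> - \<bar>q - 1\<bar>\<close>, so it is enough that \<open>2 \<bar>q - 1\<bar> < cos \<alpha> - \<beta>\<close>. Writing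
  \<open>q - 1 = (z g' - g) / g\<close> and using the triangle inequality on both series, this holds as soon
  as \<open>\<beta> < cos \<alpha>\<close> and the sum over \<open>n \<ge> 2\<close> of \<open>(2 n - cos \<alpha> - \<beta>) \<bar>a n\<bar>\<close> is at most \<open>cos \<alpha> - \<beta>\<close>; this is
  \<open>class_SP_coeff_criterion\<close>.

  For \<open>a n = n * w (n - 1)\<close> the sum is, with \<open>m = n - 1\<close>, that of
  \<open>(m + 1) (2 (m + 1) - cos \<alpha> - \<beta>) w m\<close> over \<open>m \<ge> 1\<close>. Since the series for \<open>u\<close> converges beyond
  the unit disc, it can be evaluated at 1 together with its derivatives, and the sum becomes the
  left-hand side of the hypothesis on \<open>u\<close> at 1. As all its terms are positive, that hypothesis
  also forces \<open>\<beta> < cos \<alpha>\<close>, which the inequality defining \<open>class_SP\<close> requires at the origin.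
\<close>

text \<open>
  The Euler operator \<open>z d/dz\<close> acts on power series by multiplying the \<open>n\<close>-th coefficient by \<open>n\<close>,
  with no index shift and on the same disc, so the lemma can be iterated.
\<close>
lemma power_series_euler_operator:
  fixes a :: "nat \<Rightarrow> complex"
  assumes sums: "\<And>z. norm z < K \<Longrightarrow> (\<lambda>n. a n * z ^ n) sums f z"
    and z: "norm z < K"
  shows "f field_differentiable at z"
    and "(\<lambda>n. of_nat n * a n * z ^ n) sums (z * deriv f z)"
proof -
  have "((\<lambda>z. \<Sum>n. a n * z ^ n) has_field_derivative (\<Sum>n. diffs a n * z ^ n)) (at z)"
    by (rule termdiffs_strong'[OF _ z]) (use sums in \<open>auto simp: sums_iff\<close>)
  then have D: "(f has_field_derivative (\<Sum>n. diffs a n * z ^ n)) (at z)"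
    by (rule has_field_derivative_transform_within_open[where S = "ball 0 K"])
      (use sums z in \<open>auto simp: sums_iff\<close>)
  then show "f field_differentiable at z"
    by (auto simp: field_differentiable_def)
  have "summable (\<lambda>n. diffs a n * z ^ n)"
    by (rule termdiff_converges[OF z]) (use sums in \<open>auto simp: sums_iff\<close>)
  then have "(\<lambda>n. diffs a n * z ^ n) sums deriv f z"
    using DERIV_imp_deriv[OF D] by (simp add: summable_sums)
  then have "(\<lambda>n. z * (diffs a n * z ^ n)) sums (z * deriv f z)"
    by (rule sums_mult)
  then have "(\<lambda>n. of_nat (Suc n) * a (Suc n) * z ^ Suc n) sums (z * deriv f z)"
    by (simp add: diffs_def mult_ac)
  then show "(\<lambda>n. of_nat n * a n * z ^ n) sums (z * deriv f z)"
    by (subst (asm) sums_Suc_iff) simp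
qed

lemma class_A_power_series:
  fixes a :: "nat \<Rightarrow> complex"
  assumes sums: "\<And>z. norm z < 1 \<Longrightarrow> (\<lambda>n. a n * z ^ n) sums f z"
    and a01: "a 0 = 0" "a 1 = 1"
  shows "f \<in> class_A"
proof -
  have "f holomorphic_on unit_disc"
    using power_series_euler_operator(1)[OF sums]
    by (auto simp: holomorphic_on_def unit_disc_def intro: field_differentiable_at_within)
  moreover have "(\<lambda>n. a (n + 2) * z ^ (n + 2)) sums (f z - z)" if "z \<in> unit_disc" for z
    using sums_split_initial_segment[OF sums, of z 2] that a01
    by (simp add: unit_disc_def numeral_2_eq_2)
  ultimately show ?thesis
    by (auto simp: class_A_def)
qed

text \<open>
  For \<open>\<bar>z\<bar> = r < 1\<close> put \<open>P = \<Sum> (n-1) \<bar>a n\<bar> r^(n-1)\<close> and \<open>Q = \<Sum> \<bar>a n\<bar> r^(n-1)\<close>, both over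
  \<open>n \<ge> 2\<close>, and \<open>D = cos \<alpha> - \<beta>\<close>. Then \<open>\<bar>z g' - g\<bar> \<le> r P\<close> and \<open>\<bar>g\<bar> \<ge> r (1 - Q)\<close>, while
  \<open>2 (n-1) + D \<le> 2 n - cos \<alpha> - \<beta>\<close>,
  which is just \<open>cos \<alpha> \<le> 1\<close>, turns the hypothesis into \<open>2 P + D Q \<le> r D < D\<close>. This gives
  both \<open>Q < 1\<close>, so that \<open>g\<close> vanishes only at 0, and \<open>2 P / (1 - Q) < D\<close>.
\<close>
lemma class_SP_coeff_criterion:
  fixes a :: "nat \<Rightarrow> complex"
  assumes sums: "\<And>z. norm z < 1 \<Longrightarrow> (\<lambda>n. a n * z ^ n) sums g z"
    and a01: "a 0 = 0" "a 1 = 1"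
    and D: "\<beta> < cos \<alpha>"
    and summ: "summable (\<lambda>n. (2 * real (n + 2) - cos \<alpha> - \<beta>) * norm (a (n + 2)))"
    and bound: "(\<Sum>n. (2 * real (n + 2) - cos \<alpha> - \<beta>) * norm (a (n + 2))) \<le> cos \<alpha> - \<beta>"
  shows "g \<in> class_SP \<alpha> \<beta>"
proof -
  define D where "D = cos \<alpha> - \<beta>"
  have D0: "D > 0" using D by (simp add: D_def)
  have cos1: "cos \<alpha> \<le> 1" by simp
  define T where "T = (\<lambda>n. (2 * real (n + 2) - cos \<alpha> - \<beta>) * norm (a (n + 2)))"
  have key: "Re (exp (- \<i> * of_real \<alpha>) * log_deriv_quot g z) > cmod (log_deriv_quot g z - 1) + \<beta>"
    if z: "norm z < 1" for z
  proof -
    define q where "q = log_deriv_quot g z"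
    have "2 * norm (q - 1) < D"
    proof (cases "z = 0")
      case True
      then show ?thesis using D0 by (simp add: q_def log_deriv_quot_def)
    next
      case False
      define r where "r = norm z"
      have r: "0 < r" "r < 1" using z False by (auto simp: r_def)
      define p where "p = (\<lambda>n. real (n + 1) * norm (a (n + 2)) * r ^ (n + 1))"
      define s where "s = (\<lambda>n. norm (a (n + 2)) * r ^ (n + 1))"
      have s0: "0 \<le> s n" and p0: "0 \<le> p n" for n
        using r by (auto simp: s_def p_def)
      have pointwise: "2 * p n + D * s n \<le> r * T n" for n
      proof -
        have "r ^ (n + 1) \<le> r"
          using r by (simp add: mult_left_le power_le_one)
        moreover have "2 * real (n + 1) + D \<le> 2 * real (n + 2) - cos \<alpha> - \<beta>"
          using cos1 by (simp add: D_def)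
        ultimately have "(2 * real (n + 1) + D) * norm (a (n + 2)) * r ^ (n + 1)
            \<le> (2 * real (n + 2) - cos \<alpha> - \<beta>) * norm (a (n + 2)) * r"
          using r D0 by (intro mult_mono mult_right_mono mult_nonneg_nonneg) auto
        then show ?thesis
          by (simp add: p_def s_def T_def algebra_simps)
      qed
      have rT: "summable (\<lambda>n. r * T n)"
        using summ by (intro summable_mult) (simp add: T_def)
      have sum_p: "summable p"
      proof (rule summable_comparison_test'[OF rT])
        fix n show "norm (p n) \<le> r * T n"
          using pointwise[of n] p0[of n] mult_nonneg_nonneg[OF less_imp_le[OF D0] s0[of n]]
          unfolding real_norm_def by linarith
      qed
      have sum_s: "summable s"
      proof (rule summable_comparison_test'[OF sum_p])
        fix n show "norm (s n) \<le> p n"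
          using s0[of n] mult_nonneg_nonneg[OF of_nat_0_le_iff[of n] s0[of n]]
          by (simp add: p_def s_def algebra_simps)
      qed
      have "2 * suminf p + D * suminf s = (\<Sum>n. 2 * p n + D * s n)"
        using sum_p sum_s by (simp add: suminf_add[symmetric] suminf_mult)
      also have "\<dots> \<le> (\<Sum>n. r * T n)"
        by (rule suminf_le[OF pointwise _ rT]) (intro summable_add summable_mult sum_p sum_s)
      also have "\<dots> = r * suminf T"
        using summ by (intro suminf_mult) (simp add: T_def)
      also have "\<dots> \<le> r * D"
        using bound r by (simp add: T_def D_def)
      also have "\<dots> < D" using r D0 by simp
      finally have PQ: "2 * suminf p + D * suminf s < D" .
      have P0: "0 \<le> suminf p" by (intro suminf_nonneg sum_p p0)
      have Q1: "suminf s < 1"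
      proof -
        have "D * suminf s < D * 1" using PQ P0 by linarith
        then show ?thesis using D0 by (metis mult_less_cancel_left_pos)
      qed
      have norm_terms: "norm (of_nat (n + 1) * a (n + 2) * z ^ (n + 2)) = r * p n"
        "norm (a (n + 2) * z ^ (n + 2)) = r * s n" for n
        unfolding norm_mult norm_power norm_of_nat p_def s_def r_def by simp_all

      have "(\<lambda>n. of_nat n * a n * z ^ n - a n * z ^ n) sums (z * deriv g z - g z)"
        using z by (intro sums_diff power_series_euler_operator(2)[OF sums] sums)
      from sums_split_initial_segment[OF this, of 2]
      have num: "(\<lambda>n. of_nat (n + 1) * a (n + 2) * z ^ (n + 2)) sums (z * deriv g z - g z)"
        using a01 by (simp add: numeral_2_eq_2 algebra_simps)
      have "norm (z * deriv g z - g z) \<le> (\<Sum>n. r * p n)"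
        unfolding sums_unique[OF num]
        by (intro norm_suminf_le summable_mult sum_p eq_refl norm_terms)
      then have num_le: "norm (z * deriv g z - g z) \<le> r * suminf p"
        by (simp add: suminf_mult[OF sum_p])

      have den: "(\<lambda>n. a (n + 2) * z ^ (n + 2)) sums (g z - z)"
        using sums_split_initial_segment[OF sums[OF z], of 2] a01
        by (simp add: numeral_2_eq_2)
      have "norm (g z - z) \<le> (\<Sum>n. r * s n)"
        unfolding sums_unique[OF den]
        by (intro norm_suminf_le summable_mult sum_s eq_refl norm_terms)
      then have "norm (g z - z) \<le> r * suminf s"
        by (simp add: suminf_mult[OF sum_s])
      moreover have "r \<le> norm (g z) + norm (g z - z)"
        unfolding r_def by (metis norm_minus_commute norm_triangle_sub)
      ultimately have den_ge: "r * (1 - suminf s) \<le> norm (g z)"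
        by (simp add: algebra_simps)
      moreover have "0 < r * (1 - suminf s)" using r Q1 by simp
      ultimately have gpos: "0 < norm (g z)" by linarith

      have "q - 1 = (z * deriv g z - g z) / g z"
        using False gpos by (simp add: q_def log_deriv_quot_def field_simps)
      then have "2 * norm (q - 1) * norm (g z) = 2 * norm (z * deriv g z - g z)"
        using gpos by (simp add: norm_divide)
      also have "\<dots> \<le> r * (2 * suminf p)" using num_le by simp
      also have "\<dots> < r * (D * (1 - suminf s))"
        using PQ r by (intro mult_strict_left_mono) (auto simp: algebra_simps)
      also have "\<dots> \<le> D * norm (g z)"
        using den_ge D0 by (metis mult.left_commute mult_le_cancel_left_pos)
      finally show ?thesis
        using gpos by simp
    qed
    moreover have "Re (exp (- \<i> * of_real \<alpha>) * q) \<ge> cos \<alpha> - norm (q - 1)"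
    proof -
      have "exp (- \<i> * of_real \<alpha>) = cis (- \<alpha>)"
        by (simp add: cis_conv_exp)
      then have "Re (exp (- \<i> * of_real \<alpha>) * q) = cos \<alpha> + Re (cis (- \<alpha>) * (q - 1))"
        by (simp add: algebra_simps)
      moreover have "\<bar>Re (cis (- \<alpha>) * (q - 1))\<bar> \<le> norm (q - 1)"
        using abs_Re_le_cmod[of "cis (- \<alpha>) * (q - 1)"] by (simp add: norm_mult)
      ultimately show ?thesis by linarith
    qed
    ultimately show ?thesis
      by (simp add: q_def D_def)
  qed
  then show ?thesis
    using class_A_power_series[OF sums a01] by (simp add: class_SP_def unit_disc_def)
qed

text \<open>
  The bound \<open>pochhammer \<kappa> n \<ge> \<kappa> ^ n\<close> dominates the Bessel series by that of the exponential
  function at \<open>\<bar>c z / (4 \<kappa>)\<bar>\<close>, so it converges everywhere.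
\<close>
lemma gen_bessel_sums:
  fixes c \<kappa> :: real
  assumes \<kappa>: "bessel_kappa p b = of_real \<kappa>" "\<kappa> > 0"
  shows "(\<lambda>n. of_real ((- c / 4) ^ n / (pochhammer \<kappa> n * fact n)) * z ^ n)
           sums gen_bessel p b (of_real c) z"
proof -
  let ?w = "\<lambda>n. (- c / 4) ^ n / (pochhammer \<kappa> n * fact n)"
  have poch: "\<kappa> ^ n \<le> pochhammer \<kappa> n" for n
  proof -
    have "(\<Prod>i\<in>{0..<n}. \<kappa>) \<le> (\<Prod>i\<in>{0..<n}. \<kappa> + of_nat i)"
      using \<kappa> by (intro prod_mono) auto
    then show ?thesis by (simp add: pochhammer_prod)
  qed
  have "summable (\<lambda>n. of_real (?w n) * z ^ n)"
  proof (rule summable_comparison_test'[OF summable_exp[of "\<bar>c\<bar> / 4 * norm z / \<kappa>"]])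
    fix n :: nat
    have "norm (of_real (?w n) * z ^ n) = (\<bar>c\<bar> / 4 * norm z) ^ n / (pochhammer \<kappa> n * fact n)"
      using pochhammer_pos[OF \<kappa>(2), of n]
      by (simp add: norm_mult norm_divide norm_power power_mult_distrib power_divide abs_mult power_abs)
    also have "\<dots> \<le> (\<bar>c\<bar> / 4 * norm z) ^ n / (\<kappa> ^ n * fact n)"
      using poch[of n] \<kappa> by (intro divide_left_mono mult_right_mono mult_pos_pos) 
        (auto simp: pochhammer_pos)
    also have "\<dots> = inverse (fact n) * (\<bar>c\<bar> / 4 * norm z / \<kappa>) ^ n"
      by (simp add: power_divide divide_simps)
    finally show "norm (of_real (?w n) * z ^ n) \<le> inverse (fact n) * (\<bar>c\<bar> / 4 * norm z / \<kappa>) ^ n" .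
  qed
  then show ?thesis
    unfolding gen_bessel_def \<kappa> pochhammer_of_real by (simp add: summable_sums)
qed

theorem theorem2p5:
  fixes \<alpha> \<beta> c \<kappa> :: real and p b :: complex and u :: "complex \<Rightarrow> complex"
  assumes "\<bar>\<alpha>\<bar> < pi / 2" and "0 \<le> \<beta>" and "\<beta> < 1"
    and "bessel_kappa p b = of_real \<kappa>"
    and "c < 0" and "\<kappa> > 0"
    and "u = gen_bessel p b (of_real c)"
    and "2 * Re (deriv (deriv u) 1) + (6 - cos \<alpha> - \<beta>) * Re (deriv u 1)
           + (2 - cos \<alpha> - \<beta>) * (Re (u 1) - 1) \<le> cos \<alpha> - \<beta>"
  shows "(\<lambda>z. z * u z) \<in> class_UCSP \<alpha> \<beta>"
proof -
  define w where "w = (\<lambda>n. (- c / 4) ^ n / (pochhammer \<kappa> n * fact n))"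
  have w_pos: "w n > 0" for n
    using assms by (simp add: w_def pochhammer_pos)
  have w0: "w 0 = 1" by (simp add: w_def)
  define C where "C = cos \<alpha> + \<beta>"
  have C: "C \<le> 2" using cos_le_one[of \<alpha>] \<open>\<beta> < 1\<close> unfolding C_def by linarith

  have u: "(\<lambda>n. of_real (w n) * z ^ n) sums u z" for z
    using gen_bessel_sums[OF assms(4,6)] by (simp add: w_def assms(7))
  have u_diff: "u field_differentiable at z" for z
    by (rule power_series_euler_operator(1)[OF u, of _ "norm z + 1"]) auto
  have \<theta>u: "(\<lambda>n. of_nat n * of_real (w n) * z ^ n) sums (z * deriv u z)" for z
    by (rule power_series_euler_operator(2)[OF u, of _ "norm z + 1"]) auto
  have "(\<lambda>n. of_nat n * (of_nat n * of_real (w n)) * 1 ^ n) sums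
          (1 * deriv (\<lambda>z. z * deriv u z) 1)"
    by (rule power_series_euler_operator(2)[OF \<theta>u, of _ 2]) auto
  moreover have "deriv (\<lambda>z. z * deriv u z) 1 = deriv u 1 + deriv (deriv u) 1"
  proof -
    have "u holomorphic_on UNIV"
      using u_diff by (simp add: holomorphic_on_def)
    then have "deriv u holomorphic_on UNIV"
      by (rule holomorphic_deriv) simp
    then have "deriv u field_differentiable at 1"
      by (rule holomorphic_on_imp_differentiable_at) auto
    then show ?thesis by simp
  qed
  ultimately have "(\<lambda>n. of_real (real n * real n * w n)) sums
      (deriv u 1 + deriv (deriv u) 1)"
    by (simp add: mult.assoc)
  from sums_Re[OF this]
  have s2: "(\<lambda>n. real n * real n * w n) sums (Re (deriv u 1) + Re (deriv (deriv u) 1))"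
    by simp
  have s1: "(\<lambda>n. real n * w n) sums Re (deriv u 1)"
    using sums_Re[OF \<theta>u[of 1]] by simp
  have s0: "w sums Re (u 1)"
    using sums_Re[OF u[of 1]] by simp

  define L where "L = 2 * Re (deriv (deriv u) 1) + (6 - C) * Re (deriv u 1)
           + (2 - C) * (Re (u 1) - 1)"
  define t where "t = (\<lambda>n. real (n + 1) * (2 * real (n + 1) - C) * w n)"
  \<comment> \<open>Expand \<open>(n + 1) (2 (n + 1) - C)\<close> in powers of \<open>n\<close>; its value \<open>2 - C\<close> at \<open>n = 0\<close> is the
     term that turns \<open>u 1\<close> into \<open>u 1 - 1\<close> in \<open>L\<close>.\<close>
  have "(\<lambda>n. 2 * (real n * real n * w n) + (4 - C) * (real n * w n) + (2 - C) * w n) sums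
      (2 * (Re (deriv u 1) + Re (deriv (deriv u) 1)) + (4 - C) * Re (deriv u 1) + (2 - C) * Re (u 1))"
    by (intro sums_add sums_mult s0 s1 s2)
  also have "(\<lambda>n. 2 * (real n * real n * w n) + (4 - C) * (real n * w n) + (2 - C) * w n) = t"
    by (auto simp: t_def fun_eq_iff algebra_simps)
  also have "2 * (Re (deriv u 1) + Re (deriv (deriv u) 1)) + (4 - C) * Re (deriv u 1)
      + (2 - C) * Re (u 1) = L + (2 - C)"
    by (simp add: L_def algebra_simps)
  finally have "t sums (L + (2 - C))" .
  then have t: "(\<lambda>n. t (Suc n)) sums L"
    by (subst sums_Suc_iff) (simp add: t_def w0)
  have L_le: "L \<le> cos \<alpha> - \<beta>"
    using assms(8) by (simp add: L_def C_def algebra_simps)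
  have t_pos: "t (Suc n) > 0" for n
    using C w_pos[of "Suc n"] by (simp add: t_def)
  have "L > 0"
    using suminf_pos[OF sums_summable[OF t] t_pos] sums_unique[OF t] by simp
  then have D: "\<beta> < cos \<alpha>" using L_le by simp

  \<comment> \<open>The value at 0 matters: \<open>w (0 - 1) = w 0 = 1\<close>, whereas \<open>z * u z\<close> vanishes at the origin.\<close>
  define a where "a = (\<lambda>n. if n = 0 then 0 else complex_of_real (w (n - 1)))"
  have f: "(\<lambda>n. a n * z ^ n) sums (z * u z)" for z
  proof -
    have "(\<lambda>n. a (Suc n) * z ^ Suc n) sums (z * u z)"
      using sums_mult[OF u[of z], of z] by (simp add: a_def mult_ac)
    then show ?thesis
      by (subst (asm) sums_Suc_iff) (simp add: a_def)
  qed
  have f_A: "(\<lambda>z. z * u z) \<in> class_A"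
    by (rule class_A_power_series[OF f]) (auto simp: a_def w0)
  have terms: "(2 * real (n + 2) - cos \<alpha> - \<beta>) * norm (of_nat (n + 2) * a (n + 2)) = t (Suc n)" for n
  proof -
    have "norm (of_nat (n + 2) * a (n + 2)) = real (n + 2) * w (Suc n)"
      using w_pos[of "Suc n"] unfolding norm_mult norm_of_nat by (simp add: a_def)
    then show ?thesis by (simp add: t_def C_def algebra_simps)
  qed
  have "(\<lambda>z. z * deriv (\<lambda>z. z * u z) z) \<in> class_SP \<alpha> \<beta>"
  proof (rule class_SP_coeff_criterion)
    show "(\<lambda>n. of_nat n * a n * z ^ n) sums (z * deriv (\<lambda>z. z * u z) z)" if "norm z < 1" for z
      using that by (rule power_series_euler_operator(2)[OF f])
    show "summable (\<lambda>n. (2 * real (n + 2) - cos \<alpha> - \<beta>) * norm (of_nat (n + 2) * a (n + 2)))"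
      unfolding terms using t by (rule sums_summable)
    show "(\<Sum>n. (2 * real (n + 2) - cos \<alpha> - \<beta>) * norm (of_nat (n + 2) * a (n + 2))) \<le> cos \<alpha> - \<beta>"
      unfolding terms sums_unique[OF t, symmetric] by (rule L_le)
  qed (use D in \<open>auto simp: a_def w0\<close>)
  with f_A show ?thesis
    by (simp add: class_UCSP_def)
qed

end
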